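(* Let $F$ be an algebraically closed field of characteristic different from $2$. There exist no isotopically simple strongly degenerate commutative algebras over $F$ (unitality is not assumed). That is, no strongly degenerate commutative algebra over $F$ is isotopically simple.
   Context: An algebra over $F$ is a vector space with a bilinear multiplication (not necessarily associative). An algebra is simple if its multiplication is nonzero and it has no ideals other than $0$ and itself. For $n\ge 2$, a simple $(n+1)$-dimensional algebra is called strongly degenerate if it contains an $n$-dimensional subalgebra with zero multiplication. Algebras $(A,\cdot)$ and $(B,\circ)$ are isotopic (and $B$ is called an isotope of $A$) if there are linear isomorphisms $\varphi,\psi,\xi:A\to B$ with $\varphi(a)\circ\psi(b)=\xi(a\cdot b)$ for all $a,b\in A$. An algebra is isotopically simple if every isotope of it is a simple algebra. *)

theory Defs
  imports "HOL-Computational_Algebra.Polynomial"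
begin

locale nonassoc_algebra = vector_space scale
  for scale :: "'f::field \<Rightarrow> 'a::ab_group_add \<Rightarrow> 'a" +
  fixes mult :: "'a \<Rightarrow> 'a \<Rightarrow> 'a"
  assumes linear_mult_left: "Vector_Spaces.linear scale scale (\<lambda>x. mult x y)"
    and linear_mult_right: "Vector_Spaces.linear scale scale (\<lambda>y. mult x y)"
begin

definition is_subalgebra :: "'a set \<Rightarrow> bool" where
  "is_subalgebra S \<longleftrightarrow> subspace S \<and> (\<forall>x\<in>S. \<forall>y\<in>S. mult x y \<in> S)"

definition is_ideal :: "'a set \<Rightarrow> bool" where
  "is_ideal I \<longleftrightarrow> subspace I \<and> (\<forall>a. \<forall>x\<in>I. mult a x \<in> I \<and> mult x a \<in> I)"

definition simple :: bool where
  "simple \<longleftrightarrow> (\<exists>x y. mult x y \<noteq> 0) \<and> (\<forall>I. is_ideal I \<longrightarrow> I = {0} \<or> I = UNIV)"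

definition commutative :: bool where
  "commutative \<longleftrightarrow> (\<forall>x y. mult x y = mult y x)"

text \<open>The library sets \<^term>\<open>dim V\<close> to 0 for infinite-dimensional \<open>V\<close>, so the positive
  values required below entail finite dimension.\<close>

definition strongly_degenerate :: bool where
  "strongly_degenerate \<longleftrightarrow>
     simple \<and>
     (\<exists>n\<ge>2. dim UNIV = n + 1 \<and>
        (\<exists>S. is_subalgebra S \<and> dim S = n \<and> (\<forall>x\<in>S. \<forall>y\<in>S. mult x y = 0)))"

end

definition linear_iso ::
  "('f::field \<Rightarrow> 'a::ab_group_add \<Rightarrow> 'a) \<Rightarrow> ('f \<Rightarrow> 'b::ab_group_add \<Rightarrow> 'b) \<Rightarrow> ('a \<Rightarrow> 'b) \<Rightarrow> bool" where
  "linear_iso s s' f \<longleftrightarrow> Vector_Spaces.linear s s' f \<and> bij f"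

definition isotopic ::
  "('f::field \<Rightarrow> 'a::ab_group_add \<Rightarrow> 'a) \<Rightarrow> ('a \<Rightarrow> 'a \<Rightarrow> 'a) \<Rightarrow>
   ('f \<Rightarrow> 'b::ab_group_add \<Rightarrow> 'b) \<Rightarrow> ('b \<Rightarrow> 'b \<Rightarrow> 'b) \<Rightarrow> bool" where
  "isotopic s m s' m' \<longleftrightarrow>
     (\<exists>\<phi> \<psi> \<xi>. linear_iso s s' \<phi> \<and> linear_iso s s' \<psi> \<and> linear_iso s s' \<xi> \<and>
        (\<forall>a b. m' (\<phi> a) (\<psi> b) = \<xi> (m a b)))"

text \<open>A formula cannot quantify over types, so the isotopes range over the algebras whose
  additive group is that of \<^typ>\<open>'a\<close>. This loses nothing: the lemma below the definition
  carries simplicity over to isotopes on every other type.\<close>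

definition isotopically_simple ::
  "('f::field \<Rightarrow> 'a::ab_group_add \<Rightarrow> 'a) \<Rightarrow> ('a \<Rightarrow> 'a \<Rightarrow> 'a) \<Rightarrow> bool" where
  "isotopically_simple s m \<longleftrightarrow>
     (\<forall>s' (m' :: 'a \<Rightarrow> 'a \<Rightarrow> 'a).
        nonassoc_algebra s' m' \<and> isotopic s m s' m' \<longrightarrow> nonassoc_algebra.simple s' m')"

lemma isotopically_simple_any_type:
  fixes s :: "'f::field \<Rightarrow> 'a::ab_group_add \<Rightarrow> 'a" and s' :: "'f \<Rightarrow> 'b::ab_group_add \<Rightarrow> 'b"
  assumes A: "nonassoc_algebra s m" and simp_A: "isotopically_simple s m"
    and B: "nonassoc_algebra s' m'" and iso: "isotopic s m s' m'"
  shows "nonassoc_algebra.simple s' m'"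
proof -
  interpret A: nonassoc_algebra s m by fact
  interpret B: nonassoc_algebra s' m' by fact
  obtain \<phi> \<psi> \<xi> where
    lin: "Vector_Spaces.linear s s' \<phi>" "Vector_Spaces.linear s s' \<psi>" "Vector_Spaces.linear s s' \<xi>"
    and bij: "bij \<phi>" "bij \<psi>" "bij \<xi>"
    and eq: "\<And>a b. m' (\<phi> a) (\<psi> b) = \<xi> (m a b)"
    using iso unfolding isotopic_def linear_iso_def by blast
  interpret X: Vector_Spaces.linear s s' \<xi> by fact
  define \<eta> where "\<eta> = inv \<xi>"
  have \<eta>\<xi> [simp]: "\<eta> (\<xi> x) = x" and \<xi>\<eta> [simp]: "\<xi> (\<eta> y) = y" for x y
    using bij(3) unfolding \<eta>_def by (simp_all add: bij_is_inj bij_is_surj surj_f_inv_f)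
  have bij_\<eta>: "bij \<eta>" unfolding \<eta>_def using bij(3) by (rule bij_imp_bij_inv)
  have lin_\<eta>: "Vector_Spaces.linear s' s \<eta>"
  proof unfold_locales
    show "\<eta> (x + y) = \<eta> x + \<eta> y" for x y
      by (metis X.add \<eta>\<xi> \<xi>\<eta>)
    show "\<eta> (s' r x) = s r (\<eta> x)" for r x
      by (metis X.scale \<eta>\<xi> \<xi>\<eta>)
  qed
  define m2 where "m2 = (\<lambda>a b. \<eta> (m' (\<xi> a) (\<xi> b)))"
  have m2: "nonassoc_algebra s m2"
  proof unfold_locales
    fix x y z r
    interpret L: Vector_Spaces.linear s' s' "\<lambda>x. m' x (\<xi> z)" by (rule B.linear_mult_left)
    interpret R: Vector_Spaces.linear s' s' "\<lambda>x. m' (\<xi> z) x" by (rule B.linear_mult_right)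
    interpret E: Vector_Spaces.linear s' s \<eta> by (rule lin_\<eta>)
    show "m2 (x + y) z = m2 x z + m2 y z" "m2 z (x + y) = m2 z x + m2 z y"
      "m2 (s r x) z = s r (m2 x z)" "m2 z (s r x) = s r (m2 z x)"
      unfolding m2_def by (simp_all add: X.add X.scale L.add R.add L.scale R.scale E.add E.scale)
  qed
  have "isotopic s m s m2"
    unfolding isotopic_def linear_iso_def
  proof (intro exI conjI allI)
    show "Vector_Spaces.linear s s (\<eta> \<circ> \<phi>)" "Vector_Spaces.linear s s (\<eta> \<circ> \<psi>)"
      using lin lin_\<eta> by (auto intro: Vector_Spaces.linear_compose)
    show "Vector_Spaces.linear s s id" by (rule A.linear_id)
    show "bij (\<eta> \<circ> \<phi>)" "bij (\<eta> \<circ> \<psi>)" using bij bij_\<eta> by (auto intro: bij_comp)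
    show "bij (id :: 'a \<Rightarrow> 'a)" by simp
    show "m2 ((\<eta> \<circ> \<phi>) a) ((\<eta> \<circ> \<psi>) b) = id (m a b)" for a b
      by (simp add: m2_def eq)
  qed
  with m2 simp_A have simp2: "nonassoc_algebra.simple s m2"
    unfolding isotopically_simple_def by blast
  interpret C: nonassoc_algebra s m2 by fact
  show ?thesis unfolding B.simple_def
  proof (intro conjI allI impI)
    obtain x y where "m2 x y \<noteq> 0" using simp2 unfolding C.simple_def by blast
    then have "m' (\<xi> x) (\<xi> y) \<noteq> 0" unfolding m2_def by (metis X.zero \<eta>\<xi>)
    then show "\<exists>x y. m' x y \<noteq> 0" by blast
  next
    fix I assume I: "B.is_ideal I"
    have "C.is_ideal (\<xi> -` I)"
      unfolding C.is_ideal_def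
    proof (intro conjI allI ballI)
      show "A.subspace (\<xi> -` I)"
        using I by (simp add: B.is_ideal_def X.subspace_vimage)
      show "m2 a x \<in> \<xi> -` I" "m2 x a \<in> \<xi> -` I" if "x \<in> \<xi> -` I" for a x
        using I that by (simp_all add: B.is_ideal_def m2_def)
    qed
    then have "\<xi> -` I = {0} \<or> \<xi> -` I = UNIV" using simp2 unfolding C.simple_def by blast
    moreover have "\<xi> ` (\<xi> -` I) = I" using bij(3) by (simp add: bij_is_surj)
    ultimately show "I = {0} \<or> I = UNIV"
      using X.zero bij(3) by (metis bij_is_surj image_empty image_insert)
  qed
qed

end

theory Submission
  imports Defs
begin

text \<open>
  Write the algebra as \<open>A = S \<oplus> F v\<close>, where \<open>S\<close> is the hyperplane with zero multiplication.
  A vector \<open>s\<close> of \<open>S\<close> annihilates \<open>S\<close>, so multiplication by \<open>s\<close> only sees the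
  coefficient of \<open>v\<close>: all products \<open>s x\<close>, and by commutativity all products \<open>x s\<close>, lie on the
  single line \<open>F r\<close> with \<open>r = s v\<close>. Let \<open>\<xi>\<close> be a linear automorphism of \<open>A\<close>
  that moves \<open>r\<close> into \<open>F s\<close>. Then \<open>\<xi>(x y)\<close> is an isotopic multiplication for which the line
  \<open>F s\<close> is an ideal, and it is a proper ideal because \<open>dim A = n + 1 > 1\<close>.

  Commutativity enters because it makes one line contain both the \<open>s x\<close> and the \<open>x s\<close>;
  an injective \<open>\<xi>\<close> cannot map two distinct lines into \<open>F s\<close>.
\<close>

context vector_space
begin

text \<open>If \<open>r\<close> and \<open>s\<close> are independent, an automorphism that exchanges them is
  obtained by extending them to a basis; it is bijective because it is an involution.\<close>

lemma linear_iso_into_line: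
  assumes "s \<noteq> 0"
  obtains \<xi> where "linear_iso scale scale \<xi>" "\<xi> r \<in> span {s}"
proof (cases "r \<in> span {s}")
  case True
  have "linear_iso scale scale (\<lambda>x. x)"
    unfolding linear_iso_def using linear_ident by (simp add: bij_def)
  with True show ?thesis using that by blast
next
  case False
  interpret vector_space_pair scale scale by unfold_locales
  have "independent {r, s}"
    using False assms by (simp add: independent_insert)
  define B where "B = extend_basis {r, s}"
  have B: "independent B" "span B = UNIV" and rs: "r \<in> B" "s \<in> B"
    using \<open>independent {r, s}\<close> extend_basis_superset[of "{r, s}"]
    by (auto simp: B_def independent_extend_basis span_extend_basis)
  define swap where "swap b = (if b = r then s else if b = s then r else b)" for b
  obtain \<xi> where lin: "Vector_Spaces.linear scale scale \<xi>" and \<xi>: "\<forall>b\<in>B. \<xi> b = swap b"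
    using linear_independent_extend[OF B(1)] by blast
  have "(\<xi> \<circ> \<xi>) x = id x" for x
  proof (rule linear_eq_on[where f = "\<xi> \<circ> \<xi>" and g = id])
    show "Vector_Spaces.linear scale scale (\<xi> \<circ> \<xi>)"
      by (rule Vector_Spaces.linear_compose[OF lin lin])
    show "Vector_Spaces.linear scale scale id" by (rule linear_id)
    show "x \<in> span B" by (simp add: B)
    show "(\<xi> \<circ> \<xi>) b = id b" if "b \<in> B" for b
      using that rs \<xi> by (auto simp: swap_def)
  qed
  then have "bij \<xi>" by (intro o_bij[of \<xi> \<xi>]) auto
  moreover have "\<xi> r \<in> span {s}" using rs \<xi> by (simp add: swap_def span_base)
  ultimately show ?thesis using that lin by (auto simp: linear_iso_def)
qed

lemma hyperplane_complement:
  assumes "dim UNIV = dim S + 1"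
  obtains v where "\<And>x. \<exists>c. x - scale c v \<in> span S"
proof -
  obtain B where B: "B \<subseteq> S" "independent B" "S \<subseteq> span B" "card B = dim S"
    using basis_exists .
  define E where "E = extend_basis B"
  have E: "independent E" "span E = UNIV" "B \<subseteq> E"
    using B(2) extend_basis_superset
    by (auto simp: E_def independent_extend_basis span_extend_basis)
  then have "card E = dim S + 1"
    using dim_eq_card[of E UNIV] assms by simp
  moreover have "finite E" using calculation card.infinite by fastforce
  ultimately have "card (E - B) = 1"
    using E(3) B(4) by (simp add: card_Diff_subset finite_subset)
  then obtain v where "E - B = {v}" by (auto simp: card_1_singleton_iff)
  then have "E = insert v B" using E(3) by blast
  then have "\<exists>c. x - scale c v \<in> span B" for x
    using E(2) span_breakdown_eq[of x v B] by simp
  then show ?thesis using that span_mono[OF B(1)] by blast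
qed

end

context nonassoc_algebra
begin

text \<open>Products are governed by \<open>\<xi>\<close> alone, so a line whose products fill at most a line can be
  turned into an ideal by an isotopy that leaves both factors in place.\<close>

lemma not_isotopically_simple_if_products_on_line:
  assumes comm: "commutative" and s: "s \<noteq> 0" "span {s} \<noteq> UNIV"
    and line: "\<And>x. mult s x \<in> span {r}"
  shows "\<not> isotopically_simple scale mult"
proof
  assume simple_isotopes: "isotopically_simple scale mult"
  obtain \<xi> where iso: "linear_iso scale scale \<xi>" and r: "\<xi> r \<in> span {s}"
    using linear_iso_into_line[OF s(1)] .
  have lin: "Vector_Spaces.linear scale scale \<xi>" using iso by (simp add: linear_iso_def)
  interpret \<xi>: Vector_Spaces.linear scale scale \<xi> by (rule lin)
  define m where "m x y = \<xi> (mult x y)" for x y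
  interpret M: nonassoc_algebra scale m
  proof
    fix x y z c
    interpret L: Vector_Spaces.linear scale scale "\<lambda>x. mult x z" by (rule linear_mult_left)
    interpret R: Vector_Spaces.linear scale scale "\<lambda>x. mult z x" by (rule linear_mult_right)
    show "m (x + y) z = m x z + m y z" "m (scale c x) z = scale c (m x z)"
      "m z (x + y) = m z x + m z y" "m z (scale c x) = scale c (m z x)"
      by (simp_all add: m_def L.add L.scale R.add R.scale \<xi>.add \<xi>.scale)
  qed
  have "linear_iso scale scale (\<lambda>x. x)"
    unfolding linear_iso_def using linear_ident by (simp add: bij_def)
  with iso have "isotopic scale mult scale m"
    unfolding isotopic_def m_def by blast
  then have "M.simple"
    using simple_isotopes M.nonassoc_algebra_axioms unfolding isotopically_simple_def by blast
  moreover have "M.is_ideal (span {s})"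
    unfolding M.is_ideal_def
  proof (intro conjI allI ballI)
    show "subspace (span {s})" by simp
    fix a x assume "x \<in> span {s}"
    then obtain c where c: "x = scale c s" by (auto simp: span_singleton)
    obtain d where d: "mult s a = scale d r" using line[of a] by (auto simp: span_singleton)
    interpret L: Vector_Spaces.linear scale scale "\<lambda>x. mult x a" by (rule linear_mult_left)
    have "m x a = scale c (scale d (\<xi> r))" by (simp only: m_def c L.scale d \<xi>.scale)
    then show "m x a \<in> span {s}" using r by (simp add: span_scale)
    moreover have "m a x = m x a" using comm by (simp add: m_def commutative_def)
    ultimately show "m a x \<in> span {s}" by simp
  qed
  ultimately have "span {s} = {0}" using s(2) by (auto simp: M.simple_def)
  then show False using s(1) span_base[of s "{s}"] by simp
qed

end

theorem proposition6p2:
  fixes scale :: "'f::alg_closed_field \<Rightarrow> 'a::ab_group_add \<Rightarrow> 'a"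
    and mult :: "'a \<Rightarrow> 'a \<Rightarrow> 'a"
  assumes "CHAR('f) \<noteq> 2"
    and "nonassoc_algebra scale mult"
    and "nonassoc_algebra.commutative mult"
    and "nonassoc_algebra.strongly_degenerate scale mult"
  shows "\<not> isotopically_simple scale mult"
proof -
  interpret nonassoc_algebra scale mult by fact
  obtain n S where n: "n \<ge> 2" "dim UNIV = n + 1"
    and S: "subspace S" "dim S = n" and null: "\<And>x y. x \<in> S \<Longrightarrow> y \<in> S \<Longrightarrow> mult x y = 0"
    using assms(4) unfolding strongly_degenerate_def is_subalgebra_def by blast
  obtain v where v: "\<And>x. \<exists>c. x - scale c v \<in> S"
    using hyperplane_complement[of S] n S by (metis span_eq_iff)
  have "\<not> S \<subseteq> {0}"
    using n(1) S(2) dim_le_card[of S "{}"] by auto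
  then obtain s where s: "s \<in> S" "s \<noteq> 0" by blast
  have "dim (span {s}) \<noteq> dim UNIV"
    using s(2) n by (simp add: dim_eq_card_independent)
  then have "span {s} \<noteq> UNIV" by metis
  moreover have "mult s x \<in> span {mult s v}" for x
  proof -
    obtain c where c: "x - scale c v \<in> S" using v by blast
    interpret R: Vector_Spaces.linear scale scale "\<lambda>x. mult s x" by (rule linear_mult_right)
    have "mult s x = scale c (mult s v)"
      using null[OF s(1) c] by (simp add: R.diff R.scale)
    then show ?thesis by (simp add: span_base span_scale)
  qed
  ultimately show ?thesis
    using not_isotopically_simple_if_products_on_line assms(3) s(2) by blast
qed

end
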